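(* Let $\mathscr{A}$ be a complex Banach algebra with unit $1$. Let $a,\delta a\in\mathscr{A}$ and let $p,q\in\mathscr{A}$ be idempotents such that $a^{(l)}_{p,q}$ exists. Put $\bar a=a+\delta a$. Then the following statements are equivalent: (1) $1+a^{(l)}_{p,q}\,\delta a$ is invertible, $R_r(\bar a)=K_r(q)$, and $\bar a^{(l)}_{p,q}$ exists with $\bar a^{(l)}_{p,q}=a^{(l)}_{p,q}(1+\delta a\,a^{(l)}_{p,q})^{-1}$; (2) $R_r(\bar a)\cap R_r(q)=\{0\}$, $K_r(\bar a)\cap R_r(p)=\{0\}$ and $\bar a R_r(p)=K_r(q)$.
   Context: For $x\in\mathscr{A}$ let $R_r(x)=\{xy: y\in\mathscr{A}\}$ and $K_r(x)=\{y\in\mathscr{A}: xy=0\}$; for a subset $M\subset\mathscr{A}$, $xM=\{xm:m\in M\}$. For $a\in\mathscr{A}$ and idempotents $p,q\in\mathscr{A}$, the $(p,q,l)$-generalized inverse $a^{(l)}_{p,q}$ is an element $b\in\mathscr{A}$ with $aba=a$, $bab=b$, $R_r(b)=R_r(p)$, $K_r(b)=R_r(q)$; it is unique if it exists. *)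

theory Defs
  imports Complex_Main
begin

text \<open>
  The distribution has no complex normed algebras, so the complex structure is added to a real
  Banach algebra with unit; its real scalar multiplication is the restriction of the complex one.
  The unit comes from \<^class>\<open>monoid_mult\<close> instead of \<^class>\<open>real_normed_algebra_1\<close> or
  \<^class>\<open>ring_1\<close>, so that neither \<open>norm 1 = 1\<close> nor \<open>0 \<noteq> 1\<close> is imposed.
\<close>

class complex_banach_algebra = real_normed_algebra + monoid_mult + banach +
  fixes scaleC :: "complex \<Rightarrow> 'a \<Rightarrow> 'a"  (infixr \<open>*\<^sub>C\<close> 75)
  assumes scaleC_add_right: "c *\<^sub>C (x + y) = c *\<^sub>C x + c *\<^sub>C y"
    and scaleC_add_left: "(c + d) *\<^sub>C x = c *\<^sub>C x + d *\<^sub>C x"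
    and scaleC_scaleC: "c *\<^sub>C (d *\<^sub>C x) = (c * d) *\<^sub>C x"
    and scaleC_of_real: "complex_of_real r *\<^sub>C x = r *\<^sub>R x"
    and mult_scaleC_left: "(c *\<^sub>C x) * y = c *\<^sub>C (x * y)"
    and mult_scaleC_right: "x * (c *\<^sub>C y) = c *\<^sub>C (x * y)"
    and norm_scaleC: "norm (c *\<^sub>C x) = cmod c * norm x"

definition R_r :: "'a::complex_banach_algebra \<Rightarrow> 'a set" where
  "R_r x = {x * y | y. y \<in> UNIV}"

definition K_r :: "'a::complex_banach_algebra \<Rightarrow> 'a set" where
  "K_r x = {y. x * y = 0}"

definition is_idempotent :: "'a::complex_banach_algebra \<Rightarrow> bool" where
  "is_idempotent p \<longleftrightarrow> p * p = p"

definition is_inverse :: "'a::complex_banach_algebra \<Rightarrow> 'a \<Rightarrow> bool" where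
  "is_inverse x y \<longleftrightarrow> x * y = 1 \<and> y * x = 1"

definition is_invertible :: "'a::complex_banach_algebra \<Rightarrow> bool" where
  "is_invertible x \<longleftrightarrow> (\<exists>y. is_inverse x y)"

text \<open>Meaningful only for invertible arguments.\<close>

definition alg_inv :: "'a::complex_banach_algebra \<Rightarrow> 'a" where
  "alg_inv x = (THE y. is_inverse x y)"

definition is_gen_inv_l ::
    "'a::complex_banach_algebra \<Rightarrow> 'a \<Rightarrow> 'a \<Rightarrow> 'a \<Rightarrow> bool" where
  "is_gen_inv_l a p q b \<longleftrightarrow>
     a * b * a = a \<and> b * a * b = b \<and> R_r b = R_r p \<and> K_r b = R_r q"

definition has_gen_inv_l :: "'a::complex_banach_algebra \<Rightarrow> 'a \<Rightarrow> 'a \<Rightarrow> bool" where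
  "has_gen_inv_l a p q \<longleftrightarrow> (\<exists>b. is_gen_inv_l a p q b)"

text \<open>Meaningful only under \<^const>\<open>has_gen_inv_l\<close>.\<close>

definition gen_inv_l :: "'a::complex_banach_algebra \<Rightarrow> 'a \<Rightarrow> 'a \<Rightarrow> 'a" where
  "gen_inv_l a p q = (THE b. is_gen_inv_l a p q b)"

lemma is_inverse_unique:
  assumes "is_inverse x y" "is_inverse x z"
  shows "y = z"
proof -
  have "y = y * (x * z)" using assms by (simp add: is_inverse_def)
  also have "\<dots> = y * x * z" by (simp add: mult.assoc)
  also have "\<dots> = z" using assms by (simp add: is_inverse_def)
  finally show ?thesis .
qed

lemma is_gen_inv_l_unique:
  assumes b: "is_gen_inv_l a p q b" and c: "is_gen_inv_l a p q c"
  shows "b = c"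
proof -
  have "c * 1 \<in> R_r c" unfolding R_r_def by blast
  then have "c \<in> R_r b" using b c by (simp add: is_gen_inv_l_def)
  then obtain x where x: "c = b * x" unfolding R_r_def by blast
  have "b * a * c = b * a * b * x" by (simp add: x mult.assoc)
  also have "\<dots> = c" using b x by (simp add: is_gen_inv_l_def)
  finally have 1: "b * a * c = c" .
  have "c * (a * c - 1) = 0"
    using c by (simp add: is_gen_inv_l_def right_diff_distrib mult.assoc)
  then have "a * c - 1 \<in> K_r c" by (simp add: K_r_def)
  then have "a * c - 1 \<in> K_r b" using b c by (simp add: is_gen_inv_l_def)
  then have "b * a * c = b" by (simp add: K_r_def right_diff_distrib mult.assoc)
  with 1 show ?thesis by simp
qed

end

theory Submission
  imports Defs
begin

text \<open>
  Write \<open>b\<close> for the generalized inverse of \<open>a\<close> and \<open>a'\<close> for the perturbed element. The implication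
  from (1) to (2) only uses the defining equations of the generalized inverse of \<open>a'\<close>. Conversely,
  (2) makes left multiplication by \<open>a'\<close> a bijection from \<open>R\<^sub>r(p)\<close> onto \<open>K\<^sub>r(q) = R\<^sub>r(a')\<close>, while \<open>b\<close>
  maps \<open>K\<^sub>r(q)\<close> onto \<open>R\<^sub>r(p)\<close>. Hence \<open>1 + b \<delta>a = (1 - b a) + b a'\<close> is bijective by left
  multiplication, that is, invertible, with inverse \<open>y\<close> say. Then \<open>y b = b (1 + \<delta>a b)\<^sup>-\<^sup>1\<close>, and this
  element is the generalized inverse of \<open>a'\<close>.
\<close>

lemma mem_R_r: "x \<in> R_r a \<longleftrightarrow> (\<exists>y. x = a * y)"
  by (auto simp: R_r_def)

lemma mem_K_r: "x \<in> K_r a \<longleftrightarrow> a * x = 0"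
  by (simp add: K_r_def)

lemma mult_mem_R_r: "a * y \<in> R_r a"
  by (auto simp: mem_R_r)

lemma self_mem_R_r: "a \<in> R_r a"
  using mult_mem_R_r[of a 1] by simp

lemma alg_inv_eqI: "is_inverse x y \<Longrightarrow> alg_inv x = y"
  unfolding alg_inv_def by (blast intro: is_inverse_unique)

lemma gen_inv_l_eqI: "is_gen_inv_l a p q b \<Longrightarrow> gen_inv_l a p q = b"
  unfolding gen_inv_l_def by (blast intro: is_gen_inv_l_unique)

lemma is_gen_inv_l_gen_inv_l: "has_gen_inv_l a p q \<Longrightarrow> is_gen_inv_l a p q (gen_inv_l a p q)"
  unfolding has_gen_inv_l_def using gen_inv_l_eqI by metis

text \<open>Jacobson's lemma: multiplying both equations for \<open>y\<close> by \<open>d\<close> on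
  the left and by \<open>b\<close> on the right gives the two inverse identities.\<close>

lemma is_inverse_one_plus_swap:
  fixes b d y :: "'a::complex_banach_algebra"
  assumes "is_inverse (1 + b * d) y"
  shows "is_inverse (1 + d * b) (1 - d * y * b)"
proof -
  have 1: "y + b * d * y = 1" and 2: "y + y * b * d = 1"
    using assms by (simp_all add: is_inverse_def algebra_simps)
  have "d * (y + b * d * y) * b = d * b" and "d * (y + y * b * d) * b = d * b"
    by (simp_all add: 1 2)
  then show ?thesis
    by (simp add: is_inverse_def algebra_simps)
qed

text \<open>On \<open>R_r q\<close>, \<open>q\<close> acts as the identity, and it kills
  \<open>R_r a\<close> by \<open>R\<close>. On \<open>R_r p = R_r c\<close>, \<open>c * a\<close>
  acts as the identity; on \<open>R_r a\<close>, \<open>a * c\<close> does.\<close>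

lemma gen_inv_l_imp_ranges:
  assumes q: "is_idempotent q" and c: "is_gen_inv_l a p q c" and R: "R_r a = K_r q"
  shows "R_r a \<inter> R_r q = {0}"
    and "K_r a \<inter> R_r p = {0}"
    and "(\<lambda>m. a * m) ` R_r p = K_r q"
proof -
  have aca: "a * c * a = a" and cac: "c * a * c = c" and Rc: "R_r p = R_r c"
    using c by (simp_all add: is_gen_inv_l_def)
  have "x = 0" if x: "x \<in> R_r a" "x \<in> R_r q" for x
  proof -
    obtain y where y: "x = q * y" using x unfolding mem_R_r by blast
    have "q * x = x" using q by (simp add: y is_idempotent_def flip: mult.assoc)
    moreover have "q * x = 0" using x R by (simp add: mem_K_r)
    ultimately show ?thesis by simp
  qed
  moreover have "x = 0" if x: "x \<in> K_r a" "x \<in> R_r p" for x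
  proof -
    obtain y where y: "x = c * y" using x unfolding Rc mem_R_r by blast
    have "x = c * (a * x)" using cac by (simp add: y flip: mult.assoc)
    then show ?thesis using x by (simp add: mem_K_r)
  qed
  ultimately show "R_r a \<inter> R_r q = {0}" "K_r a \<inter> R_r p = {0}"
    using mult_mem_R_r[of _ 0] by (auto simp: mem_K_r)
  have "a * x \<in> (\<lambda>m. a * m) ` R_r c" for x
  proof (rule image_eqI)
    show "a * x = a * (c * (a * x))" using aca by (simp flip: mult.assoc)
  qed (rule mult_mem_R_r)
  then have "(\<lambda>m. a * m) ` R_r c = R_r a"
    by (auto simp: mem_R_r)
  then show "(\<lambda>m. a * m) ` R_r p = K_r q"
    by (simp add: Rc R)
qed

text \<open>Split \<open>x = q * x + (x - q * x)\<close>. The second summand lies in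
  \<open>K_r q\<close>, hence in \<open>R_r a\<close>, so \<open>q * x\<close> lies in both
  \<open>R_r a\<close> and \<open>R_r q\<close>.\<close>

lemma R_r_eq_K_r_if_direct:
  assumes q: "is_idempotent q" and "K_r q \<subseteq> R_r a" and "R_r a \<inter> R_r q = {0}"
  shows "R_r a = K_r q"
proof
  show "R_r a \<subseteq> K_r q"
  proof
    fix x assume x: "x \<in> R_r a"
    have "x - q * x \<in> K_r q"
      using q by (simp add: mem_K_r is_idempotent_def right_diff_distrib flip: mult.assoc)
    then obtain u v where u: "x = a * u" and v: "x - q * x = a * v"
      using x assms(2) unfolding mem_R_r subset_eq by blast
    have "q * x = x - a * v" by (simp flip: v)
    also have "\<dots> = a * (u - v)" by (simp add: u right_diff_distrib)
    finally have "q * x = a * (u - v)" .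
    then have "q * x \<in> R_r a \<inter> R_r q" 
      by (metis IntI mult_mem_R_r)
    then show "x \<in> K_r q" using assms(3) by (simp add: mem_K_r)
  qed
qed (fact assms(2))

lemma one_plus_gen_inv_l_mult_is_inverse:
  fixes a d p q b :: "'a::complex_banach_algebra"
  assumes q: "is_idempotent q" and b: "is_gen_inv_l a p q b"
    and Rq: "R_r (a + d) \<inter> R_r q = {0}"
    and Kp: "K_r (a + d) \<inter> R_r p = {0}"
    and im: "(\<lambda>m. (a + d) * m) ` R_r p = K_r q"
  obtains y where "is_inverse (1 + b * d) y"
proof -
  have bab: "b * a * b = b" and Rb: "R_r p = R_r b" and Kb: "K_r b = R_r q"
    using b by (simp_all add: is_gen_inv_l_def)
  have bq: "b * q = 0"
    using self_mem_R_r[of q] by (simp add: mem_K_r flip: Kb)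
  have inj: "x = 0" if x: "(1 + b * d) * x = 0" for x
  proof -
    \<comment> \<open>Left multiplication by \<open>b * a\<close> removes the summand
      \<open>1 - b * a\<close> of \<open>1 + b * d\<close>.\<close>
    have "b * (a + d) * x = b * a * ((1 + b * d) * x)"
      using bab by (simp add: algebra_simps flip: mult.assoc)
    then have bx: "b * (a + d) * x = 0" by (simp add: x)
    then have "(a + d) * x \<in> R_r q" by (simp add: mem_K_r mult.assoc flip: Kb)
    then have ax: "(a + d) * x = 0" using Rq mult_mem_R_r by blast
    have "x = (1 + b * d) * x - b * (a + d) * x + b * (a * x)"
      by (simp add: algebra_simps)
    also have "\<dots> = b * (a * x)" by (simp only: x bx) simp
    finally have "x \<in> R_r p" unfolding Rb mem_R_r by blast
    with ax show ?thesis using Kp unfolding mem_K_r[symmetric] by blast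
  qed
  have onto: "\<exists>z\<in>R_r p. b * (a + d) * z = b * w" for w
  proof -
    \<comment> \<open>Since \<open>b\<close> kills \<open>q * w\<close>, only the component of
      \<open>w\<close> in \<open>K_r q\<close> has to be reached.\<close>
    have "w - q * w \<in> K_r q"
      using q by (simp add: mem_K_r is_idempotent_def right_diff_distrib flip: mult.assoc)
    then obtain z where "z \<in> R_r p" "w - q * w = (a + d) * z" using im by blast
    then show ?thesis
      using bq by (metis diff_zero mult.assoc mult_zero_left right_diff_distrib)
  qed
  \<comment> \<open>The correction \<open>z\<close> is chosen so that \<open>b * (a + d)\<close>
    sends \<open>1 - b * a + z\<close> to \<open>b * a\<close>; being in \<open>R_r b\<close>, it is
    killed by \<open>1 - b * a\<close>.\<close>
  obtain z where z: "z \<in> R_r p" "b * (a + d) * z = b * (a - (a + d) * (1 - b * a))"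
    using onto by blast
  have baz: "b * a * z = z" using z(1) bab by (auto simp: Rb mem_R_r simp flip: mult.assoc)
  define y where "y = 1 - b * a + z"
  have "(1 + b * d) * y = (1 - b * a) * y + b * (a + d) * y"
    by (simp add: algebra_simps)
  also have "(1 - b * a) * y = 1 - b * a"
    using baz bab by (simp add: y_def algebra_simps flip: mult.assoc)
  also have "b * (a + d) * y = b * a"
    using z(2) by (simp add: y_def algebra_simps)
  finally have Ty: "(1 + b * d) * y = 1" by simp
  \<comment> \<open>An injective left multiplication turns the right inverse \<open>y\<close> into a
    two-sided one.\<close>
  have "(1 + b * d) * (y * (1 + b * d) - 1) = (1 + b * d) * y * (1 + b * d) - (1 + b * d)"
    by (simp only: right_diff_distrib mult.assoc mult_1_right)
  also have "\<dots> = 0" by (simp add: Ty)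
  finally have "y * (1 + b * d) - 1 = 0" by (rule inj)
  with Ty that show thesis by (simp add: is_inverse_def)
qed

text \<open>Everything follows from \<open>y * b = b * w\<close> with \<open>y\<close> and
  \<open>w\<close> invertible: \<open>w\<close> preserves the range of \<open>b\<close>,
  \<open>y\<close> preserves its kernel.\<close>

lemma is_gen_inv_l_perturbed:
  fixes a d p q b y :: "'a::complex_banach_algebra"
  assumes b: "is_gen_inv_l a p q b" and y: "is_inverse (1 + b * d) y"
    and Rq: "R_r (a + d) \<inter> R_r q = {0}"
  shows "is_gen_inv_l (a + d) p q (y * b)"
    and "y * b = b * alg_inv (1 + d * b)"
proof -
  have bab: "b * a * b = b" and Kb: "K_r b = R_r q" and Rb: "R_r b = R_r p"
    using b by (simp_all add: is_gen_inv_l_def)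
  have Ty: "(1 + b * d) * y = 1"
    using y by (simp add: is_inverse_def)
  define w where "w = 1 - d * y * b"
  have inv: "is_inverse (1 + d * b) w"
    unfolding w_def by (rule is_inverse_one_plus_swap[OF y])
  have "y + b * d * y = 1" using Ty by (simp add: distrib_right)
  then have "(y + b * d * y) * b = b" by simp
  then have ybw: "y * b = b * w"
    by (simp add: w_def algebra_simps)
  show "y * b = b * alg_inv (1 + d * b)"
    by (simp add: ybw alg_inv_eqI[OF inv])
  \<comment> \<open>The term \<open>1 - b * a\<close> drops out because it annihilates
    \<open>b\<close>, the left factor of \<open>y * b = b * w\<close>.\<close>
  have "b * (a + d) = (1 + b * d) - (1 - b * a)" by (simp add: algebra_simps)
  then have "b * (a + d) * (y * b) = (1 + b * d) * y * b - (1 - b * a) * (b * w)"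
    by (simp only: left_diff_distrib mult.assoc ybw)
  then have bac: "b * (a + d) * (y * b) = b"
    using bab by (simp add: Ty left_diff_distrib flip: mult.assoc)
  \<comment> \<open>The defect of the first generalized inverse equation lies in
    \<open>K_r b = R_r q\<close> and in \<open>R_r (a + d)\<close>, so \<open>Rq\<close> forces it
    to vanish.\<close>
  then have "b * ((a + d) * (y * b) * (a + d) - (a + d)) = 0"
    by (simp add: right_diff_distrib flip: mult.assoc)
  then have "(a + d) * (y * b) * (a + d) - (a + d) \<in> R_r q"
    by (simp add: mem_K_r flip: Kb)
  moreover have "(a + d) * (y * b) * (a + d) - (a + d) = (a + d) * ((y * b) * (a + d) - 1)"
    by (simp only: right_diff_distrib mult.assoc mult_1_right)
  then have "(a + d) * (y * b) * (a + d) - (a + d) \<in> R_r (a + d)"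
    by (auto simp: mem_R_r)
  ultimately have "(a + d) * (y * b) * (a + d) - (a + d) = 0"
    using Rq by blast
  then have aca: "(a + d) * (y * b) * (a + d) = a + d"
    by simp
  have cac: "y * b * (a + d) * (y * b) = y * b"
    using bac by (simp add: mult.assoc)
  have "b * x = b * w * ((1 + d * b) * x)" for x
    using inv by (metis is_inverse_def mult.assoc mult_1_left)
  then have "R_r (y * b) = R_r b"
    unfolding ybw set_eq_iff mem_R_r by (metis mult.assoc)
  moreover have "b * x = (1 + b * d) * (y * b * x)" for x
    by (metis Ty mult.assoc mult_1_left)
  then have "K_r (y * b) = K_r b"
    unfolding set_eq_iff mem_K_r by (metis mult.assoc mult_zero_right)
  ultimately show "is_gen_inv_l (a + d) p q (y * b)"
    using aca cac Rb Kb by (simp add: is_gen_inv_l_def)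
qed

theorem theorem3p8:
  fixes a \<delta>a abar p q :: "'a::complex_banach_algebra"
  assumes "is_idempotent p" and "is_idempotent q"
    and "has_gen_inv_l a p q"
    and "abar = a + \<delta>a"
  shows "(is_invertible (1 + gen_inv_l a p q * \<delta>a) \<and>
          R_r abar = K_r q \<and>
          has_gen_inv_l abar p q \<and>
          gen_inv_l abar p q = gen_inv_l a p q * alg_inv (1 + \<delta>a * gen_inv_l a p q))
     \<longleftrightarrow>
         (R_r abar \<inter> R_r q = {0} \<and>
          K_r abar \<inter> R_r p = {0} \<and>
          (\<lambda>m. abar * m) ` R_r p = K_r q)"
    (is "?L \<longleftrightarrow> ?R")
proof
  assume ?L
  then show ?R
    using gen_inv_l_imp_ranges[OF assms(2) is_gen_inv_l_gen_inv_l, of abar p] by simp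
next
  assume R: ?R
  note b = is_gen_inv_l_gen_inv_l[OF assms(3)]
  have Rq: "R_r (a + \<delta>a) \<inter> R_r q = {0}" using R assms(4) by simp
  obtain y where y: "is_inverse (1 + gen_inv_l a p q * \<delta>a) y"
    using one_plus_gen_inv_l_mult_is_inverse[OF assms(2) b Rq] R assms(4) by auto
  note c = is_gen_inv_l_perturbed[OF b y Rq]
  \<comment> \<open>The image condition gives only one inclusion; the trivial intersection with
    \<open>R_r q\<close> supplies the other.\<close>
  have "(\<lambda>m. abar * m) ` R_r p \<subseteq> R_r abar"
    by (rule image_subsetI) (rule mult_mem_R_r)
  then have "K_r q \<subseteq> R_r abar"
    using R by simp
  then have "R_r abar = K_r q"
    using R_r_eq_K_r_if_direct[OF assms(2)] R by simp
  moreover have "is_invertible (1 + gen_inv_l a p q * \<delta>a)"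
    using y by (auto simp: is_invertible_def)
  moreover have "has_gen_inv_l abar p q"
    using c(1) assms(4) by (auto simp: has_gen_inv_l_def)
  moreover have "gen_inv_l abar p q = gen_inv_l a p q * alg_inv (1 + \<delta>a * gen_inv_l a p q)"
    using gen_inv_l_eqI[OF c(1)] c(2) assms(4) by simp
  ultimately show ?L by blast
qed

end
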